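(* Let $\delta$ be a unimodal range map and $\mathcal{S}$ be a nonempty graded subset of $\mathsf{Cl}_\delta$ such that $\mathcal{S}$ is closed by subword reduction. For any $u,v\in\mathcal{S}$ and $1\le i\le|u|$, in $\mathbf{Cl}_{\mathcal{S}}$, $$\mathsf{F}_u\circ_i\mathsf{F}_v=\chi_\delta(u\,\square_i\,v)\sum_{w\in[u\,\square_i\,v,\;u\,\blacksquare_i\,v]_\preccurlyeq\cap\mathcal{S}}\mathsf{F}_w .$$ Moreover, when for any $n\ge1$, $\mathcal{S}(n)$ is a sublattice of $\mathsf{Cl}_\delta(n)$, if $\mathsf{F}_u\circ_i\mathsf{F}_v$ is different from $0$, then the support of this element (on the $\mathsf{F}$-basis) is the interval $[\wedge_{\mathcal{S}}(u\,\square_i\,v),\vee_{\mathcal{S}}(u\,\blacksquare_i\,v)]_\preccurlyeq$ of $\mathcal{S}$.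
   Context: $\mathbb{N}=\{0,1,2,\dots\}$ and $\mathbb{K}$ is a field of characteristic zero. A range map is a map $\delta:\mathbb{N}\setminus\{0\}\to\mathbb{N}$. It is unimodal if there are no $1\le i_1<i_2<i_3$ with $\delta(i_1)>\delta(i_2)<\delta(i_3)$. For a word $w$ on $\mathbb{N}$, $\ell(w)$ is its length, $w(i)$ its $i$-th letter, $\epsilon$ is the empty word. A $\delta$-cliff is a word $w$ on $\mathbb{N}$ with $0\le w(i)\le\delta(i)$ for all $i$; its size is $|w|:=\ell(w)+1$; $\mathsf{Cl}_\delta$ is the set of all $\delta$-cliffs, graded by size, and $\mathsf{Cl}_\delta(n)$ its subset of elements of size $n$ (same notation $\mathcal{S}(n)$). $\chi_\delta(w):=1$ if $w\in\mathsf{Cl}_\delta$, $0$ otherwise. The $\delta$-reduction of a word $w$ is the $\delta$-cliff $\mathrm{r}_\delta(w)$ with $i$-th letter $\min\{w(i),\delta(i)\}$. For words $u,v$ and $1\le i\le|u|$, $u\,\square_i\,v:=u(1)\cdots u(i-1)\;v\;u(i)\cdots u(\ell(u))$. For $\delta$ unimodal, $\mathbf{Cl}_\delta$ is the nonsymmetric operad over $\mathbb{K}$ with basis $\{\mathsf{E}_w:w\in\mathsf{Cl}_\delta\}$ ($\mathsf{E}_w$ of arity $|w|$), partial compositions $\mathsf{E}_u\circ_i\mathsf{E}_v=\chi_\delta(u\,\square_i\,v)\,\mathsf{E}_{u\,\square_i\,v}$ (that is, $0$ when $u\,\square_i\,v$ is not a $\delta$-cliff), and unit $\mathsf{E}_\epsilon$.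 Order: for $u,v$ of the same length, $u\preccurlyeq v$ iff $u(j)\le v(j)$ for all $j$; each $(\mathsf{Cl}_\delta(n),\preccurlyeq)$ is a distributive lattice (componentwise min and max). $[u,v]_\preccurlyeq$ denotes intervals. (If $u\,\square_i\,v$ is a $\delta$-cliff then so is $u\,\blacksquare_i\,v$; if not, the right-hand side above is read as $0$.) Fundamental basis of $\mathbf{Cl}_\delta$: $\mathsf{F}_w:=\sum_{w'\in\mathsf{Cl}_\delta,\,w\preccurlyeq w'}\mu_\preccurlyeq(w,w')\,\mathsf{E}_{w'}$ with $\mu_\preccurlyeq$ the Möbius function of the poset; equivalently $\mathsf{E}_w=\sum_{w'\in\mathsf{Cl}_\delta,\,w\preccurlyeq w'}\mathsf{F}_{w'}$. Operation $\blacksquare_i$: for $w\in\mathsf{Cl}_\delta$ and $f:\{1,\dots,\ell(w)\}\to\mathbb{N}\setminus\{0\}$, let $\mathrm{m}^f_\delta(w)$ be the word with $j$-th letter $\delta(f(j))$ if $w(j)=\delta(j)$, and $w(j)$ otherwise. For $u,v\in\mathsf{Cl}_\delta$ and $1\le i\le|u|$, $u\,\blacksquare_i\,v:=\mathrm{m}^f_\delta(u)\,\square_i\,\mathrm{m}^g_\delta(v)$, where $f(j):=j$ if $j\le i-1$, $f(j):=j+\ell(v)$ otherwise, and $g(j):=j+i-1$. A nonempty graded subset $\mathcal{S}\subseteq\mathsf{Cl}_\delta$ is closed by subword reduction if for any $w\in\mathcal{S}$ and any (not necessarily contiguous) subword $w'$ of $w$, $\mathrm{r}_\delta(w')\in\mathcal{S}$.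 In this case the span $\mathcal{V}_{\mathcal{S}}$ of $\{\mathsf{F}_w:w\in\mathsf{Cl}_\delta\setminus\mathcal{S}\}$ is an operad ideal and $\mathbf{Cl}_{\mathcal{S}}:=\mathbf{Cl}_\delta/\mathcal{V}_{\mathcal{S}}$ is the quotient operad; its $\mathsf{F}$-basis consists of the classes, still denoted $\mathsf{F}_w$, for $w\in\mathcal{S}$. When every $\mathcal{S}(n)$ is a sublattice of $\mathsf{Cl}_\delta(n)$, for $w\in\mathsf{Cl}_\delta(n)$, $\wedge_{\mathcal{S}}(w)$ denotes the unique minimal element of $\{w'\in\mathcal{S}:w\preccurlyeq w'\}$ and $\vee_{\mathcal{S}}(w)$ the unique maximal element of $\{w'\in\mathcal{S}:w'\preccurlyeq w\}$, when these sets are nonempty. *)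

theory Defs
  imports
    Complex_Main
    "HOL-Algebra.AbelCoset"
    "HOL-Algebra.Module"
    "HOL-Library.Poly_Mapping"
    "HOL-Library.Sublist"
begin

section \<open>Cliffs\<close>

text \<open>
  A range map is a function \<open>\<delta> :: nat \<Rightarrow> nat\<close> of which only the values at positive
  arguments are ever used. Words are lists, and the letters of a word are numbered from 1.
\<close>

definition unimodal :: "(nat \<Rightarrow> nat) \<Rightarrow> bool" where
  "unimodal \<delta> \<longleftrightarrow>
     \<not> (\<exists>i1 i2 i3. 1 \<le> i1 \<and> i1 < i2 \<and> i2 < i3 \<and> \<delta> i1 > \<delta> i2 \<and> \<delta> i2 < \<delta> i3)"

definition letter :: "nat list \<Rightarrow> nat \<Rightarrow> nat" where
  "letter w j = w ! (j - 1)"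

definition size_word :: "nat list \<Rightarrow> nat" where
  "size_word w = length w + 1"

definition cliffs :: "(nat \<Rightarrow> nat) \<Rightarrow> nat list set" where
  "cliffs \<delta> = {w. \<forall>j\<in>{1..length w}. letter w j \<le> \<delta> j}"

definition of_size :: "nat list set \<Rightarrow> nat \<Rightarrow> nat list set" where
  "of_size S n = {w \<in> S. size_word w = n}"

definition chi :: "(nat \<Rightarrow> nat) \<Rightarrow> nat list \<Rightarrow> 'k::field_char_0" where
  "chi \<delta> w = (if w \<in> cliffs \<delta> then 1 else 0)"

definition reduct :: "(nat \<Rightarrow> nat) \<Rightarrow> nat list \<Rightarrow> nat list" where
  "reduct \<delta> w = map (\<lambda>j. min (letter w j) (\<delta> j)) [1..<length w + 1]"

definition closed_by_subword_reduction :: "(nat \<Rightarrow> nat) \<Rightarrow> nat list set \<Rightarrow> bool" where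
  "closed_by_subword_reduction \<delta> S \<longleftrightarrow>
     (\<forall>w\<in>S. \<forall>w'. subseq w' w \<longrightarrow> reduct \<delta> w' \<in> S)"

text \<open>
  \<open>white_comp u i v\<close> is \<open>u \<box>\<^sub>i v\<close>. In \<open>shift_max \<delta> f w\<close>, the letters of a cliff \<open>w\<close> that
  attain their bound are replaced by the bound at the position \<open>f\<close> sends them to, so
  \<open>black_comp \<delta> u i v\<close> moves such letters to the maximal value allowed at their positions in
  \<open>u \<box>\<^sub>i v\<close>.
\<close>

definition white_comp :: "nat list \<Rightarrow> nat \<Rightarrow> nat list \<Rightarrow> nat list" where
  "white_comp u i v = take (i - 1) u @ v @ drop (i - 1) u"

definition shift_max :: "(nat \<Rightarrow> nat) \<Rightarrow> (nat \<Rightarrow> nat) \<Rightarrow> nat list \<Rightarrow> nat list" where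
  "shift_max \<delta> f w =
     map (\<lambda>j. if letter w j = \<delta> j then \<delta> (f j) else letter w j) [1..<length w + 1]"

definition black_comp :: "(nat \<Rightarrow> nat) \<Rightarrow> nat list \<Rightarrow> nat \<Rightarrow> nat list \<Rightarrow> nat list" where
  "black_comp \<delta> u i v =
     white_comp
       (shift_max \<delta> (\<lambda>j. if j \<le> i - 1 then j else j + length v) u)
       i
       (shift_max \<delta> (\<lambda>j. j + i - 1) v)"


section \<open>The componentwise order\<close>

definition cliff_le :: "nat list \<Rightarrow> nat list \<Rightarrow> bool"  (infix \<open>\<preceq>\<close> 50) where
  "u \<preceq> v \<longleftrightarrow> list_all2 (\<le>) u v"

definition interval :: "nat list set \<Rightarrow> nat list \<Rightarrow> nat list \<Rightarrow> nat list set" where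
  "interval P u v = {w \<in> P. u \<preceq> w \<and> w \<preceq> v}"

definition sublattice :: "nat list set \<Rightarrow> bool" where
  "sublattice L \<longleftrightarrow> (\<forall>u\<in>L. \<forall>v\<in>L. map2 min u v \<in> L \<and> map2 max u v \<in> L)"

definition is_minimal :: "nat list set \<Rightarrow> nat list \<Rightarrow> bool" where
  "is_minimal A m \<longleftrightarrow> m \<in> A \<and> (\<forall>x\<in>A. x \<preceq> m \<longrightarrow> x = m)"

definition is_maximal :: "nat list set \<Rightarrow> nat list \<Rightarrow> bool" where
  "is_maximal A m \<longleftrightarrow> m \<in> A \<and> (\<forall>x\<in>A. m \<preceq> x \<longrightarrow> x = m)"

definition meet_proj :: "nat list set \<Rightarrow> nat list \<Rightarrow> nat list" where
  "meet_proj S w = (THE m. is_minimal {w' \<in> S. w \<preceq> w'} m)"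

definition join_proj :: "nat list set \<Rightarrow> nat list \<Rightarrow> nat list" where
  "join_proj S w = (THE m. is_maximal {w' \<in> S. w' \<preceq> w} m)"

lemma cliff_le_iff: "u \<preceq> v \<longleftrightarrow> length u = length v \<and> (\<forall>i<length u. u ! i \<le> v ! i)"
  by (auto simp: cliff_le_def list_all2_conv_all_nth)

lemma cliff_le_sum_list_less:
  assumes "u \<preceq> v" "u \<noteq> v"
  shows "sum_list u < sum_list v"
proof -
  have len: "length u = length v" and le: "\<And>i. i < length u \<Longrightarrow> u ! i \<le> v ! i"
    using assms(1) by (auto simp: cliff_le_iff)
  obtain i where i: "i < length u" "u ! i \<noteq> v ! i"
    using len assms(2) by (meson nth_equalityI)
  have "(\<Sum>j\<in>{0..<length u}. u ! j) < (\<Sum>j\<in>{0..<length u}. v ! j)"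
  proof (rule sum_strict_mono_ex1)
    show "\<exists>j\<in>{0..<length u}. u ! j < v ! j"
      using i le[of i] by (auto intro!: bexI[of _ i])
  qed (use le in auto)
  then show ?thesis
    using len by (simp add: sum_list_sum_nth)
qed

text \<open>
  In a sublattice, the two projections above are well defined.
\<close>

lemma ex1_minimal:
  assumes "\<forall>n\<ge>1. sublattice (of_size S n)" and "{w' \<in> S. w \<preceq> w'} \<noteq> {}"
  shows "\<exists>!m. is_minimal {w' \<in> S. w \<preceq> w'} m"
proof -
  let ?A = "{w' \<in> S. w \<preceq> w'}"
  obtain a where "a \<in> ?A"
    using assms(2) by blast
  then obtain m where m: "m \<in> ?A" and least: "\<And>x. x \<in> ?A \<Longrightarrow> sum_list m \<le> sum_list x"
    using ex_has_least_nat[of "\<lambda>x. x \<in> ?A" a sum_list] by blast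
  have "is_minimal ?A m"
    unfolding is_minimal_def
    using m least cliff_le_sum_list_less leD by blast
  moreover have "m' = m''" if m': "is_minimal ?A m'" and m'': "is_minimal ?A m''" for m' m''
  proof -
    have in': "m' \<in> S" "w \<preceq> m'" and in'': "m'' \<in> S" "w \<preceq> m''"
      using m' m'' by (auto simp: is_minimal_def)
    let ?c = "map2 min m' m''"
    have "?c \<in> of_size S (size_word w)"
      using assms(1) in' in''
      by (auto simp: sublattice_def of_size_def size_word_def cliff_le_iff)
    then have "?c \<in> ?A"
      using in' in'' by (auto simp: of_size_def cliff_le_iff)
    moreover have "?c \<preceq> m'" "?c \<preceq> m''"
      using in' in'' by (auto simp: cliff_le_iff)
    ultimately show ?thesis
      using m' m'' unfolding is_minimal_def by metis
  qed
  ultimately show ?thesis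
    by blast
qed

lemma ex1_maximal:
  assumes "\<forall>n\<ge>1. sublattice (of_size S n)" and "{w' \<in> S. w' \<preceq> w} \<noteq> {}"
  shows "\<exists>!m. is_maximal {w' \<in> S. w' \<preceq> w} m"
proof -
  let ?A = "{w' \<in> S. w' \<preceq> w}"
  have bound: "sum_list x < Suc (sum_list w)" if "x \<in> ?A" for x
    using that cliff_le_sum_list_less[of x w] by (cases "x = w") auto
  obtain a where "a \<in> ?A"
    using assms(2) by blast
  then obtain m where m: "m \<in> ?A" and greatest: "\<And>x. x \<in> ?A \<Longrightarrow> sum_list x \<le> sum_list m"
    using ex_has_greatest_nat[of "\<lambda>x. x \<in> ?A" a sum_list "Suc (sum_list w)"] bound by blast
  have "is_maximal ?A m"
    unfolding is_maximal_def
    using m greatest cliff_le_sum_list_less leD by blast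
  moreover have "m' = m''" if m': "is_maximal ?A m'" and m'': "is_maximal ?A m''" for m' m''
  proof -
    have in': "m' \<in> S" "m' \<preceq> w" and in'': "m'' \<in> S" "m'' \<preceq> w"
      using m' m'' by (auto simp: is_maximal_def)
    let ?c = "map2 max m' m''"
    have "?c \<in> of_size S (size_word w)"
      using assms(1) in' in''
      by (auto simp: sublattice_def of_size_def size_word_def cliff_le_iff)
    then have "?c \<in> ?A"
      using in' in'' by (auto simp: of_size_def cliff_le_iff)
    moreover have "m' \<preceq> ?c" "m'' \<preceq> ?c"
      using in' in'' by (auto simp: cliff_le_iff)
    ultimately show ?thesis
      using m' m'' unfolding is_maximal_def by metis
  qed
  ultimately show ?thesis
    by blast
qed

text \<open>
  Moebius function of the poset of all \<open>\<delta>\<close>-cliffs (cliffs of different sizes are incomparable,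
  so this is the Moebius function of each of its graded pieces).
\<close>

function moebius :: "(nat \<Rightarrow> nat) \<Rightarrow> nat list \<Rightarrow> nat list \<Rightarrow> int" where
  "moebius \<delta> u w =
     (if u = w then 1
      else if u \<preceq> w then - (\<Sum>x\<in>{x \<in> cliffs \<delta>. u \<preceq> x \<and> x \<preceq> w \<and> x \<noteq> w}. moebius \<delta> u x)
      else 0)"
  by pat_completeness auto
termination
  by (relation "measure (\<lambda>(\<delta>, u, w). sum_list w)") (auto intro: cliff_le_sum_list_less)

declare moebius.simps [simp del]


section \<open>Nonsymmetric operads in vector spaces\<close>

text \<open>
  \<open>hspace \<O> n\<close> is the vector space of elements of arity \<open>n\<close>; the ring multiplication and unit
  contained in the record \<^type>\<open>module\<close> are not part of the structure and are left unspecified.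
  \<open>pcomp \<O> n m i\<close> is the partial composition \<open>\<O>(n) \<times> \<O>(m) \<rightarrow> \<O>(n + m - 1)\<close> at
  position \<open>i\<close>, where \<open>1 \<le> i \<le> n\<close>.
\<close>

record ('k, 'v) ns_operad =
  hspace :: "nat \<Rightarrow> ('k, 'v) module"
  pcomp :: "nat \<Rightarrow> nat \<Rightarrow> nat \<Rightarrow> 'v \<Rightarrow> 'v \<Rightarrow> 'v"
  op_unit :: 'v

definition quotient_space :: "('k, 'v) module \<Rightarrow> 'v set \<Rightarrow> ('k, 'v set) module" where
  "quotient_space M N =
     \<lparr>carrier = a_rcosets\<^bsub>M\<^esub> N,
      mult = undefined,
      one = undefined,
      zero = N,
      add = set_add M,
      smult = (\<lambda>c A. \<Union>a\<in>A. N +>\<^bsub>M\<^esub> (c \<odot>\<^bsub>M\<^esub> a))\<rparr>"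

text \<open>
  The quotient of an operad by an ideal, given by its homogeneous components \<open>V n\<close>. The union of
  the classes of all composites of representatives is a single class when \<open>V\<close> is an ideal.
\<close>

definition quotient_operad ::
    "('k, 'v) ns_operad \<Rightarrow> (nat \<Rightarrow> 'v set) \<Rightarrow> ('k, 'v set) ns_operad" where
  "quotient_operad \<O> V =
     \<lparr>hspace = (\<lambda>n. quotient_space (hspace \<O> n) (V n)),
      pcomp = (\<lambda>n m i A B. \<Union>a\<in>A. \<Union>b\<in>B.
        V (n + m - 1) +>\<^bsub>hspace \<O> (n + m - 1)\<^esub> pcomp \<O> n m i a b),
      op_unit = V 1 +>\<^bsub>hspace \<O> 1\<^esub> op_unit \<O>\<rparr>"


section \<open>The operad of cliffs\<close>

type_synonym 'k lin = "nat list \<Rightarrow>\<^sub>0 'k"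

definition scale :: "'k::field_char_0 \<Rightarrow> 'k lin \<Rightarrow> 'k lin" where
  "scale c x = Poly_Mapping.map ((*) c) x"

lemma lookup_scale: "Poly_Mapping.lookup (scale c x) w = c * Poly_Mapping.lookup x w"
  by (auto simp: scale_def map.rep_eq when_def)

interpretation lin: vector_space scale
  by unfold_locales (auto intro!: poly_mapping_eqI simp: lookup_scale lookup_add algebra_simps)

definition E_elem :: "nat list \<Rightarrow> 'k::field_char_0 lin" where
  "E_elem w = Poly_Mapping.single w 1"

definition cliff_space :: "(nat \<Rightarrow> nat) \<Rightarrow> nat \<Rightarrow> ('k::field_char_0, 'k lin) module" where
  "cliff_space \<delta> n =
     \<lparr>carrier = lin.span (E_elem ` of_size (cliffs \<delta>) n),
      mult = undefined,
      one = undefined,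
      zero = 0,
      add = (+),
      smult = scale\<rparr>"

text \<open>
  Bilinear extension of \<open>E_elem u \<circ>\<^sub>i E_elem v = \<chi>\<^sub>\<delta>(u \<box>\<^sub>i v) E_elem (u \<box>\<^sub>i v)\<close>.
\<close>

definition cliff_pcomp ::
    "(nat \<Rightarrow> nat) \<Rightarrow> nat \<Rightarrow> 'k::field_char_0 lin \<Rightarrow> 'k lin \<Rightarrow> 'k lin" where
  "cliff_pcomp \<delta> i x y =
     (\<Sum>u\<in>Poly_Mapping.keys x. \<Sum>v\<in>Poly_Mapping.keys y.
        scale (Poly_Mapping.lookup x u * Poly_Mapping.lookup y v)
          (scale (chi \<delta> (white_comp u i v)) (E_elem (white_comp u i v))))"

definition cliff_operad :: "(nat \<Rightarrow> nat) \<Rightarrow> ('k::field_char_0, 'k lin) ns_operad" where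
  "cliff_operad \<delta> =
     \<lparr>hspace = cliff_space \<delta>,
      pcomp = (\<lambda>n m i. cliff_pcomp \<delta> i),
      op_unit = E_elem []\<rparr>"

definition F_elem :: "(nat \<Rightarrow> nat) \<Rightarrow> nat list \<Rightarrow> 'k::field_char_0 lin" where
  "F_elem \<delta> w = (\<Sum>w'\<in>{w' \<in> cliffs \<delta>. w \<preceq> w'}. scale (of_int (moebius \<delta> w w')) (E_elem w'))"


section \<open>The quotient operad associated with a set of cliffs\<close>

definition ideal_of ::
    "(nat \<Rightarrow> nat) \<Rightarrow> nat list set \<Rightarrow> nat \<Rightarrow> 'k::field_char_0 lin set" where
  "ideal_of \<delta> S n = lin.span (F_elem \<delta> ` of_size (cliffs \<delta> - S) n)"

definition cliff_quotient ::
    "(nat \<Rightarrow> nat) \<Rightarrow> nat list set \<Rightarrow> ('k::field_char_0, 'k lin set) ns_operad" where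
  "cliff_quotient \<delta> S = quotient_operad (cliff_operad \<delta>) (ideal_of \<delta> S)"

definition Fcl :: "(nat \<Rightarrow> nat) \<Rightarrow> nat list set \<Rightarrow> nat list \<Rightarrow> 'k::field_char_0 lin set" where
  "Fcl \<delta> S w = ideal_of \<delta> S (size_word w) +>\<^bsub>cliff_space \<delta> (size_word w)\<^esub> F_elem \<delta> w"

text \<open>
  Coordinates of an element of arity \<open>n\<close> of the quotient on the basis
  \<open>{Fcl \<delta> S w | w \<in> S(n)}\<close>, and its support on this basis.
\<close>

definition F_coords ::
    "(nat \<Rightarrow> nat) \<Rightarrow> nat list set \<Rightarrow> nat \<Rightarrow> 'k::field_char_0 lin set \<Rightarrow> nat list \<Rightarrow> 'k" where
  "F_coords \<delta> S n X =
     (THE c. (\<forall>w. w \<notin> of_size S n \<longrightarrow> c w = 0) \<and>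
        X = (\<Oplus>\<^bsub>hspace (cliff_quotient \<delta> S) n\<^esub>w\<in>of_size S n.
               c w \<odot>\<^bsub>hspace (cliff_quotient \<delta> S) n\<^esub> Fcl \<delta> S w))"

definition F_support ::
    "(nat \<Rightarrow> nat) \<Rightarrow> nat list set \<Rightarrow> nat \<Rightarrow> 'k::field_char_0 lin set \<Rightarrow> nat list set" where
  "F_support \<delta> S n X = {w \<in> of_size S n. F_coords \<delta> S n X w \<noteq> 0}"

end

theory Submission
  imports Defs
begin

text \<open>
  Let \<open>F_coeff w x\<close> be the sum of the coordinates of \<open>x\<close> on the elementary basis over all words
  below \<open>w\<close>. By the recursion of the Moebius function these linear forms are dual to the fundamental
  basis. If a cliff \<open>w\<close> splits into an outer part \<open>o\<close> and an inner part \<open>n\<close>, then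
  \<open>white_comp u i v \<preceq> w\<close> iff \<open>u\<close> is below the reduction of \<open>o\<close> and \<open>v\<close> below that of \<open>n\<close>,
  whence \<open>F_coeff w (x \<circ>\<^sub>i y) = F_coeff (reduct o) x * F_coeff (reduct n) y\<close>. Evaluated at two
  fundamental elements \<open>u\<close>, \<open>v\<close>, the right-hand side tests whether \<open>o\<close> and \<open>n\<close> reduce to \<open>u\<close>
  and \<open>v\<close>, which means that \<open>w\<close> lies between \<open>white_comp u i v\<close> and \<open>black_comp u i v\<close>. The ideal is
  the common kernel of the forms \<open>F_coeff w\<close> with \<open>w\<close> in \<open>S\<close>, so the quotient is
  described by their values.
\<close>

section \<open>Cliffs, reduction and the componentwise order\<close>

lemma cliffs_iff_nth: "w \<in> cliffs \<delta> \<longleftrightarrow> (\<forall>k<length w. w ! k \<le> \<delta> (Suc k))"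
proof
  assume w: "w \<in> cliffs \<delta>"
  show "\<forall>k<length w. w ! k \<le> \<delta> (Suc k)"
  proof (intro allI impI)
    fix k assume "k < length w"
    then have "Suc k \<in> {1..length w}" by simp
    then have "letter w (Suc k) \<le> \<delta> (Suc k)" using w unfolding cliffs_def by blast
    then show "w ! k \<le> \<delta> (Suc k)" by (simp add: letter_def)
  qed
next
  assume w: "\<forall>k<length w. w ! k \<le> \<delta> (Suc k)"
  show "w \<in> cliffs \<delta>"
    unfolding cliffs_def letter_def
  proof (intro CollectI ballI)
    fix j assume "j \<in> {1..length w}"
    then have "j - 1 < length w" "Suc (j - 1) = j" by auto
    then show "w ! (j - 1) \<le> \<delta> j" using w by metis
  qed
qed

lemma length_reduct [simp]: "length (reduct \<delta> w) = length w"
  by (simp add: reduct_def del: upt_Suc)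

lemma nth_reduct: "k < length w \<Longrightarrow> reduct \<delta> w ! k = min (w ! k) (\<delta> (Suc k))"
  unfolding reduct_def letter_def by (subst nth_map) (simp_all del: upt_Suc)

lemma reduct_in_cliffs: "reduct \<delta> w \<in> cliffs \<delta>"
  by (auto simp: cliffs_iff_nth nth_reduct)

lemma length_shift_max [simp]: "length (shift_max \<delta> f w) = length w"
  by (simp add: shift_max_def del: upt_Suc)

lemma nth_shift_max:
  "k < length w \<Longrightarrow>
    shift_max \<delta> f w ! k = (if w ! k = \<delta> (Suc k) then \<delta> (f (Suc k)) else w ! k)"
  unfolding shift_max_def letter_def by (subst nth_map) (simp_all del: upt_Suc)

lemma cliff_le_refl [simp]: "w \<preceq> w"
  by (simp add: cliff_le_iff)

lemma cliff_le_trans: "u \<preceq> v \<Longrightarrow> v \<preceq> w \<Longrightarrow> u \<preceq> w"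
  by (fastforce simp: cliff_le_iff)

lemma cliff_le_antisym: "u \<preceq> v \<Longrightarrow> v \<preceq> u \<Longrightarrow> u = v"
  by (auto simp: cliff_le_iff intro!: nth_equalityI le_antisym)

lemma cliff_le_cliffs: "u \<preceq> w \<Longrightarrow> w \<in> cliffs \<delta> \<Longrightarrow> u \<in> cliffs \<delta>"
  by (fastforce simp: cliff_le_iff cliffs_iff_nth)

lemma size_word_cliff_le: "u \<preceq> w \<Longrightarrow> size_word u = size_word w"
  by (simp add: cliff_le_iff size_word_def)

lemma finite_cliff_le: "finite {u. u \<preceq> w}"
proof (rule finite_subset)
  \<comment> \<open>Any common bound for the letters of \<open>w\<close> gives a finite set of
    words; the letter sum is one that also covers the empty word.\<close>
  show "{u. u \<preceq> w} \<subseteq> {u. set u \<subseteq> {..sum_list w} \<and> length u = length w}"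
  proof (clarsimp simp: cliff_le_iff)
    fix u x assume le: "\<forall>i<length w. u ! i \<le> w ! i" and "length u = length w" "x \<in> set u"
    then obtain i where i: "i < length w" "x = u ! i" by (metis in_set_conv_nth)
    then have "x \<le> w ! i" using le by simp
    also have "\<dots> \<le> sum_list w" using i by (simp add: member_le_sum_list)
    finally show "x \<le> sum_list w" .
  qed
qed (simp add: finite_lists_length_eq)

lemma finite_of_size_cliffs: "finite (of_size (cliffs \<delta>) n)"
proof (rule finite_subset)
  \<comment> \<open>The word of all bounds is the largest cliff of its length. Size \<open>n\<close>
    means length \<open>n - 1\<close>, and no word has size 0.\<close>
  show "of_size (cliffs \<delta>) n \<subseteq> {u. u \<preceq> map (\<lambda>k. \<delta> (Suc k)) [0..<n - 1]}"
    by (auto simp: of_size_def size_word_def cliff_le_iff cliffs_iff_nth)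
qed (rule finite_cliff_le)

lemma finite_cliffs_above: "finite {w \<in> cliffs \<delta>. u \<preceq> w}"
  by (rule finite_subset[OF _ finite_of_size_cliffs[of \<delta> "size_word u"]])
    (auto simp: of_size_def size_word_cliff_le)

text \<open>The letters of a cliff already respect the bounds, so taking the minimum with them
  changes no comparison. Reduction is thus right adjoint to the inclusion of cliffs into
  words.\<close>

lemma le_reduct_iff: "u \<in> cliffs \<delta> \<Longrightarrow> u \<preceq> reduct \<delta> w \<longleftrightarrow> u \<preceq> w"
  by (auto simp: cliff_le_iff nth_reduct cliffs_iff_nth)

text \<open>A letter of \<open>u\<close> strictly below its bound determines the letter of
  \<open>w\<close>. A letter equal to its bound leaves the letter of \<open>w\<close> free from
  there up to the bound at the position chosen by \<open>f\<close>, which is the value that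
  \<open>shift_max\<close> puts there. Fibres of reduction are therefore intervals.\<close>

lemma reduct_eq_iff_between:
  assumes u: "u \<in> cliffs \<delta>" and len: "length w = length u"
    and bound: "\<And>k. k < length w \<Longrightarrow> w ! k \<le> \<delta> (f (Suc k))"
  shows "reduct \<delta> w = u \<longleftrightarrow> u \<preceq> w \<and> w \<preceq> shift_max \<delta> f u"
proof -
  have "reduct \<delta> w = u \<longleftrightarrow> (\<forall>k<length u. min (w ! k) (\<delta> (Suc k)) = u ! k)"
    using len by (auto simp: list_eq_iff_nth_eq nth_reduct)
  also have "\<dots> \<longleftrightarrow> (\<forall>k<length u. u ! k \<le> w ! k \<and> w ! k \<le> shift_max \<delta> f u ! k)"
  proof (intro all_cong1 imp_cong refl)
    fix k assume "k < length u"
    then have "u ! k \<le> \<delta> (Suc k)" "w ! k \<le> \<delta> (f (Suc k))"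
      using u bound len by (auto simp: cliffs_iff_nth)
    then show "min (w ! k) (\<delta> (Suc k)) = u ! k \<longleftrightarrow> u ! k \<le> w ! k \<and> w ! k \<le> shift_max \<delta> f u ! k"
      using \<open>k < length u\<close> by (auto simp: nth_shift_max)
  qed
  also have "\<dots> \<longleftrightarrow> u \<preceq> w \<and> w \<preceq> shift_max \<delta> f u"
    using len by (auto simp: cliff_le_iff)
  finally show ?thesis .
qed

section \<open>Splitting a word into an outer and an inner factor\<close>

text \<open>
  The two factors of \<open>w = white_comp u i v\<close>, where \<open>q = length v\<close>.
\<close>

definition outer :: "nat \<Rightarrow> nat \<Rightarrow> nat list \<Rightarrow> nat list" where
  "outer i q w = take (i - 1) w @ drop (i - 1 + q) w"

definition inner :: "nat \<Rightarrow> nat \<Rightarrow> nat list \<Rightarrow> nat list" where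
  "inner i q w = take q (drop (i - 1) w)"

lemma length_white_comp [simp]: "length (white_comp u i v) = length u + length v"
  by (simp add: white_comp_def)

lemma length_black_comp [simp]: "length (black_comp \<delta> u i v) = length u + length v"
  by (simp add: black_comp_def)

lemma white_comp_outer_inner:
  "white_comp (outer i q w) i (inner i q w) = w" if "i - 1 + q \<le> length w"
proof -
  have "drop (i - 1 + q) w = drop q (drop (i - 1) w)" by (simp add: add.commute)
  then have "w = take (i - 1) w @ take q (drop (i - 1) w) @ drop (i - 1 + q) w"
    by (metis append_take_drop_id)
  then show ?thesis using that by (simp add: white_comp_def outer_def inner_def)
qed

lemma length_outer: "i - 1 + q \<le> length w \<Longrightarrow> length (outer i q w) = length w - q"
  by (simp add: outer_def)

lemma length_inner: "i - 1 + q \<le> length w \<Longrightarrow> length (inner i q w) = q"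
  by (simp add: inner_def)

text \<open>Equal lengths mean that both composites are cut at the same positions, so the order can
  be tested block by block.\<close>

lemma white_comp_le_iff:
  assumes "length u = length u'" "length v = length v'"
  shows "white_comp u i v \<preceq> white_comp u' i v' \<longleftrightarrow> u \<preceq> u' \<and> v \<preceq> v'"
proof -
  have "white_comp u i v \<preceq> white_comp u' i v' \<longleftrightarrow>
      list_all2 (\<le>) (take (i - 1) u) (take (i - 1) u') \<and> v \<preceq> v' \<and>
      list_all2 (\<le>) (drop (i - 1) u) (drop (i - 1) u')"
    using assms by (simp add: white_comp_def cliff_le_def list_all2_append)
  moreover have "u \<preceq> u' \<longleftrightarrow>
      list_all2 (\<le>) (take (i - 1) u) (take (i - 1) u') \<and>
      list_all2 (\<le>) (drop (i - 1) u) (drop (i - 1) u')"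
  proof -
    have "length (take (i - 1) u) = length (take (i - 1) u')" using assms(1) by simp
    from list_all2_append[OF this, of "(\<le>)" "drop (i - 1) u" "drop (i - 1) u'"]
    show ?thesis by (simp only: append_take_drop_id cliff_le_def)
  qed
  ultimately show ?thesis by blast
qed

text \<open>Together with \<open>subseq_inner\<close>, this lets closure by subword reduction keep
  the reduced factors of a word of \<open>S\<close> inside \<open>S\<close>.\<close>

lemma subseq_outer: "subseq (outer i q w) w"
proof -
  have "suffix (drop (i - 1 + q) w) (drop (i - 1) w)"
    by (metis add.commute drop_drop suffix_drop)
  then have "subseq (take (i - 1) w @ drop (i - 1 + q) w) (take (i - 1) w @ drop (i - 1) w)"
    by (intro list_emb_append_mono suffix_imp_subseq) simp_all
  then show ?thesis by (simp add: outer_def)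
qed

lemma subseq_inner: "subseq (inner i q w) w"
  unfolding inner_def
  by (rule subseq_order.trans[OF prefix_imp_subseq[OF take_is_prefix]
        suffix_imp_subseq[OF suffix_drop]])

text \<open>Both comparisons split into one for the outer factor and one for the inner factor. For
  each factor the resulting pair of bounds describes a fibre of reduction, by
  \<open>reduct_eq_iff_between\<close>.\<close>

lemma between_white_black_iff:
  assumes u: "u \<in> cliffs \<delta>" and v: "v \<in> cliffs \<delta>" and w: "w \<in> cliffs \<delta>"
    and i: "1 \<le> i" "i \<le> size_word u" and len: "length w = length u + length v"
  shows "white_comp u i v \<preceq> w \<and> w \<preceq> black_comp \<delta> u i v \<longleftrightarrow>
    reduct \<delta> (outer i (length v) w) = u \<and> reduct \<delta> (inner i (length v) w) = v"
proof -
  let ?o = "outer i (length v) w" and ?n = "inner i (length v) w"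
  \<comment> \<open>These maps send the positions in each factor to their positions in
    \<open>w\<close>: the first \<open>i - 1\<close> letters of \<open>u\<close> stay, the others
    move past \<open>v\<close>, and \<open>v\<close> starts at position \<open>i\<close>. The bounds
    of the cliff \<open>w\<close> then become the bounds required of its factors.\<close>
  let ?f = "\<lambda>j. if j \<le> i - 1 then j else j + length v" and ?g = "\<lambda>j. j + i - 1"
  have i': "i - 1 + length v \<le> length w" using i len by (simp add: size_word_def)
  have lo: "length ?o = length u" and ln: "length ?n = length v"
    using i' len by (simp_all add: length_outer length_inner)
  have wd: "\<And>k. k < length w \<Longrightarrow> w ! k \<le> \<delta> (Suc k)" using w by (simp add: cliffs_iff_nth)
  have o: "reduct \<delta> ?o = u \<longleftrightarrow> u \<preceq> ?o \<and> ?o \<preceq> shift_max \<delta> ?f u"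
  proof (rule reduct_eq_iff_between[OF u lo])
    fix k assume "k < length ?o"
    then have k: "k < length u" by (simp add: lo)
    show "?o ! k \<le> \<delta> (?f (Suc k))"
    proof (cases "k < i - 1")
      case True
      then have "?o ! k = w ! k" using i' by (simp add: outer_def nth_append)
      then show ?thesis using True wd[of k] i' by simp
    next
      case False
      then have "?o ! k = w ! (k + length v)"
        using i' by (simp add: outer_def nth_append add.commute)
      then show ?thesis using False wd[of "k + length v"] k len by simp
    qed
  qed
  have n: "reduct \<delta> ?n = v \<longleftrightarrow> v \<preceq> ?n \<and> ?n \<preceq> shift_max \<delta> ?g v"
  proof (rule reduct_eq_iff_between[OF v ln])
    fix k assume "k < length ?n"
    then have k: "k < length v" by (simp add: ln)
    \<comment> \<open>List index \<open>i - 1 + k\<close> is position \<open>i + k\<close> of the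
      word, which equals \<open>?g (Suc k)\<close>.\<close>
    then have "?n ! k = w ! (i - 1 + k)" using i' by (simp add: inner_def)
    then show "?n ! k \<le> \<delta> (?g (Suc k))"
      using wd[of "i - 1 + k"] k i' i(1) by (simp add: add.commute)
  qed
  have "white_comp u i v \<preceq> w \<longleftrightarrow> u \<preceq> ?o \<and> v \<preceq> ?n"
    using white_comp_le_iff[of u ?o v ?n i] white_comp_outer_inner[OF i'] lo ln by simp
  moreover have "w \<preceq> black_comp \<delta> u i v \<longleftrightarrow> ?o \<preceq> shift_max \<delta> ?f u \<and> ?n \<preceq> shift_max \<delta> ?g v"
    using white_comp_le_iff[of ?o "shift_max \<delta> ?f u" ?n "shift_max \<delta> ?g v" i]
      white_comp_outer_inner[OF i'] lo ln by (simp add: black_comp_def)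
  ultimately show ?thesis using o n by blast
qed

section \<open>Linear forms dual to the fundamental basis\<close>

lemma lookup_E_elem: "Poly_Mapping.lookup (E_elem u) w = (if u = w then 1 else 0)"
  by (simp add: E_elem_def lookup_single when_def)

text \<open>Every elementary vector is the sum of the fundamental vectors above it; hence, for a
  cliff \<open>w\<close> and a combination \<open>x\<close> of cliffs, this is the coefficient of
  \<open>F_elem \<delta> w\<close> in \<open>x\<close>. Words below a cliff are cliffs, so the
  formula can be free of \<delta>.\<close>

definition F_coeff :: "nat list \<Rightarrow> 'k::field_char_0 lin \<Rightarrow> 'k" where
  "F_coeff w x = (\<Sum>w'\<in>{w'. w' \<preceq> w}. Poly_Mapping.lookup x w')"

lemma F_coeff_zero [simp]: "F_coeff w 0 = 0"
  by (simp add: F_coeff_def)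

lemma F_coeff_add: "F_coeff w (x + y) = F_coeff w x + F_coeff w y"
  by (simp add: F_coeff_def lookup_add sum.distrib)

lemma F_coeff_diff: "F_coeff w (x - y) = F_coeff w x - F_coeff w y"
  by (simp add: F_coeff_def lookup_minus sum_subtractf)

lemma F_coeff_scale: "F_coeff w (scale c x) = c * F_coeff w x"
  by (simp add: F_coeff_def lookup_scale sum_distrib_left)

lemma F_coeff_sum: "F_coeff w (\<Sum>a\<in>A. f a) = (\<Sum>a\<in>A. F_coeff w (f a))"
  by (induction A rule: infinite_finite_induct) (simp_all add: F_coeff_add)

lemma F_coeff_E_elem: "F_coeff w (E_elem u) = (if u \<preceq> w then 1 else 0)"
  using finite_cliff_le[of w] by (simp add: F_coeff_def lookup_E_elem)

text \<open>Moves the sum to the support of \<open>x\<close>, the index set of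
  \<open>cliff_pcomp\<close>, so that a product of two coefficients expands into the same double
  sum.\<close>

lemma F_coeff_keys:
  "F_coeff w x = (\<Sum>u\<in>Poly_Mapping.keys x. Poly_Mapping.lookup x u * (if u \<preceq> w then 1 else 0))"
proof -
  have "F_coeff w x = (\<Sum>u\<in>{u. u \<preceq> w} \<inter> Poly_Mapping.keys x. Poly_Mapping.lookup x u)"
    unfolding F_coeff_def
    by (rule sum.mono_neutral_right) (auto simp: finite_cliff_le in_keys_iff)
  also have "\<dots> = (\<Sum>u\<in>Poly_Mapping.keys x. Poly_Mapping.lookup x u * (if u \<preceq> w then 1 else 0))"
    by (rule sum.mono_neutral_cong_left) auto
  finally show ?thesis .
qed

text \<open>For distinct words this is the recursion of \<open>moebius\<close> with the term at the
  top word moved to the other side; otherwise antisymmetry leaves a single term.\<close>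

lemma sum_moebius:
  assumes "w \<in> cliffs \<delta>" "u \<preceq> w"
  shows "(\<Sum>x\<in>{x \<in> cliffs \<delta>. u \<preceq> x \<and> x \<preceq> w}. moebius \<delta> u x) = (if u = w then 1 else 0)"
proof (cases "u = w")
  case True
  then have "{x \<in> cliffs \<delta>. u \<preceq> x \<and> x \<preceq> w} = {w}"
    using assms by (auto intro: cliff_le_antisym)
  then show ?thesis using True by (simp add: moebius.simps)
next
  case False
  let ?A = "{x \<in> cliffs \<delta>. u \<preceq> x \<and> x \<preceq> w \<and> x \<noteq> w}"
  have "finite ?A" by (rule finite_subset[OF _ finite_cliff_le[of w]]) auto
  moreover have "{x \<in> cliffs \<delta>. u \<preceq> x \<and> x \<preceq> w} = insert w ?A" using assms by auto
  ultimately have "(\<Sum>x\<in>{x \<in> cliffs \<delta>. u \<preceq> x \<and> x \<preceq> w}. moebius \<delta> u x) =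
      moebius \<delta> u w + sum (moebius \<delta> u) ?A" by simp
  also have "moebius \<delta> u w = - sum (moebius \<delta> u) ?A"
    using False assms by (subst moebius.simps) simp
  finally show ?thesis using False by simp
qed

lemma F_coeff_F_elem:
  assumes "w \<in> cliffs \<delta>"
  shows "F_coeff w (F_elem \<delta> u) = (if u = w then 1 else 0)"
proof -
  have "F_coeff w (F_elem \<delta> u) =
      (\<Sum>x\<in>{x \<in> cliffs \<delta>. u \<preceq> x}. of_int (moebius \<delta> u x) * (if x \<preceq> w then 1 else 0))"
    by (simp add: F_elem_def F_coeff_sum F_coeff_scale F_coeff_E_elem)
  also have "\<dots> = (\<Sum>x\<in>{x \<in> cliffs \<delta>. u \<preceq> x \<and> x \<preceq> w}. of_int (moebius \<delta> u x))"
    by (rule sum.mono_neutral_cong_right) (auto simp: finite_cliffs_above)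
  also have "\<dots> = of_int (\<Sum>x\<in>{x \<in> cliffs \<delta>. u \<preceq> x \<and> x \<preceq> w}. moebius \<delta> u x)"
    by simp
  also have "\<dots> = (if u = w then 1 else 0)"
  proof (cases "u \<preceq> w")
    case True
    then show ?thesis using sum_moebius[OF assms] by simp
  next
    \<comment> \<open>Transitivity empties the interval, and reflexivity makes \<open>u\<close>
      different from \<open>w\<close>.\<close>
    case False
    then have "{x \<in> cliffs \<delta>. u \<preceq> x \<and> x \<preceq> w} = {}" by (auto dest: cliff_le_trans)
    then show ?thesis using False by (metis cliff_le_refl of_int_0 sum.empty)
  qed
  finally show ?thesis .
qed

section \<open>Homogeneous components and partial compositions\<close>

abbreviation homog :: "(nat \<Rightarrow> nat) \<Rightarrow> nat \<Rightarrow> 'k::field_char_0 lin set" where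
  "homog \<delta> n \<equiv> lin.span (E_elem ` of_size (cliffs \<delta>) n)"

lemma keys_homog: "x \<in> homog \<delta> n \<Longrightarrow> Poly_Mapping.keys x \<subseteq> of_size (cliffs \<delta>) n"
proof (induction rule: lin.span_induct_alt)
  case base
  then show ?case by simp
next
  case (step c x y)
  have "u \<in> of_size (cliffs \<delta>) n" if "u \<in> Poly_Mapping.keys (scale c x + y)" for u
    using that step by (fastforce simp: in_keys_iff lookup_add lookup_scale lookup_E_elem
        split: if_splits)
  then show ?case by blast
qed

lemma E_elem_homog: "w \<in> cliffs \<delta> \<Longrightarrow> size_word w = n \<Longrightarrow> E_elem w \<in> homog \<delta> n"
  by (auto simp: of_size_def intro: lin.span_base)

lemma F_elem_homog: "size_word w = n \<Longrightarrow> F_elem \<delta> w \<in> homog \<delta> n"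
  unfolding F_elem_def
  by (auto intro!: lin.span_sum lin.span_scale E_elem_homog simp: size_word_cliff_le)

lemma F_elem_of_size_homog: "w \<in> of_size A n \<Longrightarrow> F_elem \<delta> w \<in> homog \<delta> n"
  by (rule F_elem_homog) (simp add: of_size_def)

lemma cliff_pcomp_homog:
  assumes "x \<in> homog \<delta> n" "y \<in> homog \<delta> m"
  shows "cliff_pcomp \<delta> i x y \<in> homog \<delta> (n + m - 1)"
  unfolding cliff_pcomp_def
proof (intro lin.span_sum, rule lin.span_scale)
  fix u v assume "u \<in> Poly_Mapping.keys x" "v \<in> Poly_Mapping.keys y"
  then have "size_word u = n" "size_word v = m"
    using keys_homog[OF assms(1)] keys_homog[OF assms(2)] by (auto simp: of_size_def)
  then have "size_word (white_comp u i v) = n + m - 1" by (auto simp: size_word_def)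
  \<comment> \<open>If the composite is not a cliff, its factor \<open>chi\<close> is 0 and the term
    vanishes.\<close>
  then show "scale (chi \<delta> (white_comp u i v)) (E_elem (white_comp u i v)) \<in> homog \<delta> (n + m - 1)"
    by (auto simp: chi_def intro: E_elem_homog lin.span_zero)
qed

text \<open>
  By unitriangularity: at a key of minimal letter sum only one term of \<open>F_coeff\<close> survives.
\<close>

lemma homog_eq_0I:
  assumes x: "x \<in> homog \<delta> n" and 0: "\<And>w. w \<in> of_size (cliffs \<delta>) n \<Longrightarrow> F_coeff w x = 0"
  shows "x = 0"
proof (rule ccontr)
  assume "x \<noteq> 0"
  then obtain a where "a \<in> Poly_Mapping.keys x" by fastforce
  then obtain w where w: "w \<in> Poly_Mapping.keys x"
    and least: "\<And>v. v \<in> Poly_Mapping.keys x \<Longrightarrow> sum_list w \<le> sum_list v"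
    using ex_has_least_nat[of "\<lambda>v. v \<in> Poly_Mapping.keys x" a sum_list] by blast
  have "F_coeff w x = (\<Sum>v\<in>{w}. Poly_Mapping.lookup x v)"
    unfolding F_coeff_def
  proof (rule sum.mono_neutral_right)
    show "\<forall>v\<in>{w'. w' \<preceq> w} - {w}. Poly_Mapping.lookup x v = 0"
      using least cliff_le_sum_list_less by (fastforce simp: in_keys_iff)
  qed (auto simp: finite_cliff_le)
  then show False using w keys_homog[OF x] 0[of w] by (auto simp: in_keys_iff)
qed

text \<open>
  Since \<open>F_coeff\<close> is dual to the fundamental basis, this is the transpose of the partial
  composition in that basis.
\<close>

lemma F_coeff_pcomp:
  assumes x: "x \<in> homog \<delta> n" and y: "y \<in> homog \<delta> m"
    and w: "w \<in> of_size (cliffs \<delta>) (n + m - 1)" and m: "1 \<le> m" and i: "1 \<le> i" "i \<le> n"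
  shows "F_coeff w (cliff_pcomp \<delta> i x y) =
    F_coeff (reduct \<delta> (outer i (m - 1) w)) x * F_coeff (reduct \<delta> (inner i (m - 1) w)) y"
proof -
  let ?o = "outer i (m - 1) w" and ?n = "inner i (m - 1) w"
  let ?k = "Poly_Mapping.keys"
  have len: "length w = n - 1 + (m - 1)" and wc: "w \<in> cliffs \<delta>"
    using w m i by (auto simp: of_size_def size_word_def)
  have i': "i - 1 + (m - 1) \<le> length w" using len i by simp
  \<comment> \<open>A composite below the cliff \<open>w\<close> is itself a cliff, so
    \<open>chi\<close> is 1 whenever the comparison holds. The comparison splits over the two
    factors, and each of these may be reduced because \<open>u\<close> and \<open>v\<close> are
    cliffs.\<close>
  have *: "chi \<delta> (white_comp u i v) * (if white_comp u i v \<preceq> w then 1 else 0) =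
      ((if u \<preceq> reduct \<delta> ?o then 1 else 0) * (if v \<preceq> reduct \<delta> ?n then 1 else 0) :: 'a)"
    if "u \<in> ?k x" "v \<in> ?k y" for u v
  proof -
    have u: "u \<in> cliffs \<delta>" "length u = length ?o" and v: "v \<in> cliffs \<delta>" "length v = length ?n"
      using that keys_homog[OF x] keys_homog[OF y] len i'
      by (auto simp: of_size_def size_word_def length_outer length_inner)
    have "white_comp u i v \<preceq> w \<longleftrightarrow> u \<preceq> ?o \<and> v \<preceq> ?n"
      using white_comp_le_iff[OF u(2) v(2), of i] white_comp_outer_inner[OF i'] by simp
    then show ?thesis
      using u v wc by (auto simp: le_reduct_iff chi_def dest: cliff_le_cliffs)
  qed
  have "F_coeff w (cliff_pcomp \<delta> i x y) = (\<Sum>u\<in>?k x. \<Sum>v\<in>?k y.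
      Poly_Mapping.lookup x u * Poly_Mapping.lookup y v *
        (chi \<delta> (white_comp u i v) * (if white_comp u i v \<preceq> w then 1 else 0)))"
    by (simp only: cliff_pcomp_def F_coeff_sum F_coeff_scale F_coeff_E_elem)
  also have "\<dots> = (\<Sum>u\<in>?k x. \<Sum>v\<in>?k y.
      (Poly_Mapping.lookup x u * (if u \<preceq> reduct \<delta> ?o then 1 else 0)) *
      (Poly_Mapping.lookup y v * (if v \<preceq> reduct \<delta> ?n then 1 else 0)))"
    by (intro sum.cong refl) (simp only: * mult_ac)
  also have "\<dots> = F_coeff (reduct \<delta> ?o) x * F_coeff (reduct \<delta> ?n) y"
    by (simp only: F_coeff_keys[of _ x] F_coeff_keys[of _ y] sum_product)
  finally show ?thesis .
qed

section \<open>The ideal and the quotient spaces\<close>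

lemma ideal_of_eq:
  "ideal_of \<delta> S n =
    {x :: 'k::field_char_0 lin. x \<in> homog \<delta> n \<and> (\<forall>w\<in>of_size S n. F_coeff w x = 0)}"
  (is "_ = ?R") if "S \<subseteq> cliffs \<delta>"
proof (intro equalityI subsetI)
  fix x :: "'k lin" assume "x \<in> ideal_of \<delta> S n"
  then show "x \<in> ?R"
    unfolding ideal_of_def
  proof (induction rule: lin.span_induct_alt)
    case base
    then show ?case by (simp add: lin.span_zero)
  next
    case (step c x y)
    then obtain u where u: "u \<in> cliffs \<delta> - S" "size_word u = n" "x = F_elem \<delta> u"
      by (auto simp: of_size_def)
    then have "F_coeff w x = 0" if "w \<in> of_size S n" for w
      using that \<open>S \<subseteq> cliffs \<delta>\<close> F_coeff_F_elem[of w \<delta> u, where 'a = 'k]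
      by (auto simp: of_size_def)
    moreover have "scale c x \<in> homog \<delta> n"
      using u by (simp add: lin.span_scale F_elem_homog)
    ultimately show ?case using step by (auto simp: F_coeff_add F_coeff_scale lin.span_add)
  qed
next
  fix x :: "'k lin" assume x: "x \<in> ?R"
  let ?C = "of_size (cliffs \<delta>) n"
  \<comment> \<open>The expansion of \<open>x\<close> on the fundamental basis. By duality all the
    forms vanish on \<open>x - ?y\<close>, so \<open>homog_eq_0I\<close> yields equality.\<close>
  let ?y = "\<Sum>w\<in>?C. scale (F_coeff w x) (F_elem \<delta> w)"
  have "?y \<in> homog \<delta> n"
    by (intro lin.span_sum lin.span_scale F_elem_of_size_homog)
  moreover have "F_coeff w (x - ?y) = 0" if w: "w \<in> ?C" for w
  proof -
    have "F_coeff w ?y = (\<Sum>u\<in>?C. if u = w then F_coeff u x else 0)"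
      using w by (auto simp: F_coeff_sum F_coeff_scale of_size_def F_coeff_F_elem intro!: sum.cong)
    also have "\<dots> = F_coeff w x" using w by (simp add: finite_of_size_cliffs)
    finally show ?thesis by (simp add: F_coeff_diff)
  qed
  ultimately have "x - ?y = 0" using x by (intro homog_eq_0I) (auto intro: lin.span_diff)
  then have "x = ?y" by simp
  also have "?y \<in> ideal_of \<delta> S n"
    unfolding ideal_of_def
  proof (intro lin.span_sum)
    \<comment> \<open>For \<open>w\<close> in \<open>S\<close> the coefficient is 0 by assumption;
      otherwise the fundamental element is a generator of the ideal.\<close>
    fix w assume "w \<in> ?C"
    then show "scale (F_coeff w x) (F_elem \<delta> w) \<in> lin.span (F_elem \<delta> ` of_size (cliffs \<delta> - S) n)"
      using x by (cases "w \<in> S")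
        (auto simp: of_size_def lin.span_zero intro: lin.span_scale[OF lin.span_base])
  qed
  finally show "x \<in> ideal_of \<delta> S n" .
qed

text \<open>
  Two elements are congruent modulo the ideal iff their coefficients on \<open>S\<close> agree, so this is the
  class of \<open>x\<close> in the quotient.
\<close>

definition coset :: "(nat \<Rightarrow> nat) \<Rightarrow> nat list set \<Rightarrow> nat \<Rightarrow> 'k::field_char_0 lin \<Rightarrow> 'k lin set" where
  "coset \<delta> S n x = {a \<in> homog \<delta> n. \<forall>w\<in>of_size S n. F_coeff w a = F_coeff w x}"

lemma carrier_cliff_space: "carrier (cliff_space \<delta> n) = homog \<delta> n"
  by (simp add: cliff_space_def)

lemma r_coset_eq_coset:
  assumes "S \<subseteq> cliffs \<delta>" "x \<in> homog \<delta> n"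
  shows "ideal_of \<delta> S n +>\<^bsub>cliff_space \<delta> n\<^esub> x = coset \<delta> S n x"
proof -
  have "ideal_of \<delta> S n +>\<^bsub>cliff_space \<delta> n\<^esub> x = (\<lambda>v. v + x) ` ideal_of \<delta> S n"
    unfolding a_r_coset_def' cliff_space_def by auto
  also have "\<dots> = coset \<delta> S n x"
  proof (intro equalityI subsetI)
    fix a assume "a \<in> coset \<delta> S n x"
    then have "a - x \<in> ideal_of \<delta> S n"
      using assms by (simp add: coset_def ideal_of_eq F_coeff_diff lin.span_diff)
    then show "a \<in> (\<lambda>v. v + x) ` ideal_of \<delta> S n" by (intro image_eqI[of _ _ "a - x"]) simp_all
  qed (use assms in \<open>auto simp: coset_def ideal_of_eq F_coeff_add lin.span_add\<close>)
  finally show ?thesis .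
qed

lemma coset_eq_iff:
  assumes "x \<in> homog \<delta> n" "y \<in> homog \<delta> n"
  shows "coset \<delta> S n x = coset \<delta> S n y \<longleftrightarrow> (\<forall>w\<in>of_size S n. F_coeff w x = F_coeff w y)"
  using assms by (auto simp: coset_def)

lemma self_in_coset: "x \<in> homog \<delta> n \<Longrightarrow> x \<in> coset \<delta> S n x"
  by (simp add: coset_def)

lemma ideal_of_eq_coset: "S \<subseteq> cliffs \<delta> \<Longrightarrow> ideal_of \<delta> S n = coset \<delta> S n 0"
  by (simp add: ideal_of_eq coset_def)

lemma hspace_quotient:
  "hspace (cliff_quotient \<delta> S) n = quotient_space (cliff_space \<delta> n) (ideal_of \<delta> S n)"
  by (simp add: cliff_quotient_def quotient_operad_def cliff_operad_def)

lemma carrier_quotient: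
  assumes "S \<subseteq> cliffs \<delta>"
  shows "carrier (hspace (cliff_quotient \<delta> S) n) = coset \<delta> S n ` homog \<delta> n"
proof -
  have "carrier (hspace (cliff_quotient \<delta> S) n) =
      (\<lambda>x. ideal_of \<delta> S n +>\<^bsub>cliff_space \<delta> n\<^esub> x) ` homog \<delta> n"
    by (auto simp: hspace_quotient quotient_space_def A_RCOSETS_def' a_r_coset_def'
        carrier_cliff_space)
  also have "\<dots> = coset \<delta> S n ` homog \<delta> n"
    by (rule image_cong) (simp_all add: r_coset_eq_coset[OF assms])
  finally show ?thesis .
qed

lemma zero_quotient:
  assumes "S \<subseteq> cliffs \<delta>"
  shows "\<zero>\<^bsub>hspace (cliff_quotient \<delta> S) n\<^esub> = coset \<delta> S n 0"
  using ideal_of_eq_coset[OF assms] by (simp add: hspace_quotient quotient_space_def)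

lemma add_quotient:
  fixes x y :: "'k::field_char_0 lin"
  assumes "x \<in> homog \<delta> n" "y \<in> homog \<delta> n"
  shows "coset \<delta> S n x \<oplus>\<^bsub>hspace (cliff_quotient \<delta> S) n\<^esub> coset \<delta> S n y = coset \<delta> S n (x + y)"
proof -
  have "coset \<delta> S n x \<oplus>\<^bsub>hspace (cliff_quotient \<delta> S) n\<^esub> coset \<delta> S n y =
      {a + b |a b. a \<in> coset \<delta> S n x \<and> b \<in> coset \<delta> S n y}"
    by (auto simp: hspace_quotient quotient_space_def set_add_def' cliff_space_def)
  also have "\<dots> = coset \<delta> S n (x + y)"
  proof (intro equalityI subsetI)
    fix c assume c: "c \<in> coset \<delta> S n (x + y)"
    \<comment> \<open>Using \<open>y\<close> as its own representative, the other summand must be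
      \<open>c - y\<close>.\<close>
    then have "c - y \<in> coset \<delta> S n x"
      using assms by (simp add: coset_def F_coeff_diff F_coeff_add lin.span_diff)
    moreover have "c = (c - y) + y" by simp
    ultimately show "c \<in> {a + b |a b. a \<in> coset \<delta> S n x \<and> b \<in> coset \<delta> S n y}"
      using self_in_coset[OF assms(2), of S] by blast
  qed (auto simp: coset_def F_coeff_add lin.span_add)
  finally show ?thesis .
qed

text \<open>The product is a union of classes, one for each representative. They all coincide
  because \<open>F_coeff\<close> is linear, and the union is nonempty since \<open>x\<close> is a
  representative.\<close>

lemma smult_quotient:
  fixes x :: "'k::field_char_0 lin"
  assumes S: "S \<subseteq> cliffs \<delta>" and x: "x \<in> homog \<delta> n"
  shows "c \<odot>\<^bsub>hspace (cliff_quotient \<delta> S) n\<^esub> coset \<delta> S n x = coset \<delta> S n (scale c x)"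
proof -
  have *: "ideal_of \<delta> S n +>\<^bsub>cliff_space \<delta> n\<^esub> scale c a = coset \<delta> S n (scale c x)"
    if "a \<in> coset \<delta> S n x" for a
  proof -
    have a: "a \<in> homog \<delta> n" using that by (simp add: coset_def)
    then show ?thesis
      using that x r_coset_eq_coset[OF S, of "scale c a" n]
      by (simp add: lin.span_scale coset_eq_iff F_coeff_scale) (simp add: coset_def)
  qed
  have "c \<odot>\<^bsub>hspace (cliff_quotient \<delta> S) n\<^esub> coset \<delta> S n x =
      (\<Union>a\<in>coset \<delta> S n x. ideal_of \<delta> S n +>\<^bsub>cliff_space \<delta> n\<^esub> scale c a)"
    by (simp add: hspace_quotient quotient_space_def) (simp add: cliff_space_def)
  also have "\<dots> = coset \<delta> S n (scale c x)" using * self_in_coset[OF x, of S] by blast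
  finally show ?thesis .
qed

text \<open>The structure on which finite sums in the quotient rest; its laws pass from
  representatives to classes.\<close>

lemma abelian_monoid_quotient:
  assumes "S \<subseteq> cliffs \<delta>"
  shows "abelian_monoid (hspace (cliff_quotient \<delta> S :: ('k::field_char_0, 'k lin set) ns_operad) n)"
  by (rule abelian_monoidI)
    (auto simp: carrier_quotient[OF assms] zero_quotient[OF assms] add_quotient lin.span_add
      lin.span_zero add_ac)

lemma finsum_quotient:
  fixes f :: "'a \<Rightarrow> 'k::field_char_0 lin"
  assumes S: "S \<subseteq> cliffs \<delta>" and A: "finite A" "\<And>a. a \<in> A \<Longrightarrow> f a \<in> homog \<delta> n"
  shows "(\<Oplus>\<^bsub>hspace (cliff_quotient \<delta> S) n\<^esub>a\<in>A. coset \<delta> S n (f a)) = coset \<delta> S n (\<Sum>a\<in>A. f a)"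
proof -
  interpret H: abelian_monoid "hspace (cliff_quotient \<delta> S :: ('k, 'k lin set) ns_operad) n"
    by (rule abelian_monoid_quotient[OF S])
  show ?thesis
    using A
  proof (induction A)
    case empty
    then show ?case by (simp add: zero_quotient[OF S])
  next
    case (insert a A)
    then have "(\<lambda>a. coset \<delta> S n (f a)) \<in> A \<rightarrow> carrier (hspace (cliff_quotient \<delta> S) n)"
      and "coset \<delta> S n (f a) \<in> carrier (hspace (cliff_quotient \<delta> S) n)"
      by (auto simp: carrier_quotient[OF S])
    with insert show ?case
      by (simp add: H.finsum_insert add_quotient lin.span_sum)
  qed
qed

section \<open>Coordinates and composition in the quotient\<close>

lemma Fcl_eq_coset:
  assumes "S \<subseteq> cliffs \<delta>" "size_word w = n"
  shows "Fcl \<delta> S w = coset \<delta> S n (F_elem \<delta> w)"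
  using assms r_coset_eq_coset F_elem_homog unfolding Fcl_def by blast

text \<open>Lifts combinations of classes to representatives, where \<open>F_coeff\<close> can be
  evaluated.\<close>

lemma finsum_Fcl:
  fixes c :: "nat list \<Rightarrow> 'k::field_char_0"
  assumes S: "S \<subseteq> cliffs \<delta>" and A: "A \<subseteq> of_size S n"
  shows "(\<Oplus>\<^bsub>hspace (cliff_quotient \<delta> S) n\<^esub>w\<in>A. c w \<odot>\<^bsub>hspace (cliff_quotient \<delta> S) n\<^esub> Fcl \<delta> S w) =
    coset \<delta> S n (\<Sum>w\<in>A. scale (c w) (F_elem \<delta> w))"
proof -
  interpret H: abelian_monoid "hspace (cliff_quotient \<delta> S :: ('k, 'k lin set) ns_operad) n"
    by (rule abelian_monoid_quotient[OF S])
  have F: "F_elem \<delta> w \<in> homog \<delta> n" if "w \<in> A" for w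
    using that A by (intro F_elem_of_size_homog) blast
  have "A \<subseteq> of_size (cliffs \<delta>) n" using A S by (auto simp: of_size_def)
  then have fin: "finite A" using finite_of_size_cliffs by (rule finite_subset)
  have "(\<Oplus>\<^bsub>hspace (cliff_quotient \<delta> S) n\<^esub>w\<in>A. c w \<odot>\<^bsub>hspace (cliff_quotient \<delta> S) n\<^esub> Fcl \<delta> S w) =
      (\<Oplus>\<^bsub>hspace (cliff_quotient \<delta> S) n\<^esub>w\<in>A. coset \<delta> S n (scale (c w) (F_elem \<delta> w)))"
  proof (rule H.finsum_cong')
    fix w assume w: "w \<in> A"
    then have "Fcl \<delta> S w = coset \<delta> S n (F_elem \<delta> w :: 'k lin)"
      using A by (intro Fcl_eq_coset[OF S]) (auto simp: of_size_def)
    then show "c w \<odot>\<^bsub>hspace (cliff_quotient \<delta> S) n\<^esub> Fcl \<delta> S w =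
        coset \<delta> S n (scale (c w) (F_elem \<delta> w))"
      by (simp add: smult_quotient[OF S F[OF w]])
  qed (auto simp: carrier_quotient[OF S] intro!: imageI lin.span_scale F)
  also have "\<dots> = coset \<delta> S n (\<Sum>w\<in>A. scale (c w) (F_elem \<delta> w))"
    by (rule finsum_quotient[OF S fin]) (simp add: F lin.span_scale)
  finally show ?thesis .
qed

lemma F_coeff_sum_F_elem:
  fixes c :: "nat list \<Rightarrow> 'k::field_char_0"
  assumes S: "S \<subseteq> cliffs \<delta>" and w: "w \<in> of_size S n" and A: "A \<subseteq> of_size S n"
  shows "F_coeff w (\<Sum>a\<in>A. scale (c a) (F_elem \<delta> a)) = (if w \<in> A then c w else 0)"
proof -
  have "A \<subseteq> of_size (cliffs \<delta>) n" using A S by (auto simp: of_size_def)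
  then have fin: "finite A" using finite_of_size_cliffs by (rule finite_subset)
  have "w \<in> cliffs \<delta>" using S w by (auto simp: of_size_def)
  then have "F_coeff w (\<Sum>a\<in>A. scale (c a) (F_elem \<delta> a)) = (\<Sum>a\<in>A. if a = w then c a else 0)"
    by (auto simp: F_coeff_sum F_coeff_scale F_coeff_F_elem intro!: sum.cong)
  also have "\<dots> = (if w \<in> A then c w else 0)" using fin by simp
  finally show ?thesis .
qed

text \<open>By duality, a family \<open>c\<close> represents the class of \<open>x\<close> exactly
  when it agrees with the forms \<open>F_coeff\<close> on \<open>of_size S n\<close>. Being 0
  elsewhere, it is unique, which resolves the definite description in
  \<open>F_coords\<close>.\<close>

lemma F_coords_coset:
  fixes x :: "'k::field_char_0 lin"
  assumes S: "S \<subseteq> cliffs \<delta>" and x: "x \<in> homog \<delta> n"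
  shows "F_coords \<delta> S n (coset \<delta> S n x) = (\<lambda>w. if w \<in> of_size S n then F_coeff w x else 0)"
proof -
  have *: "coset \<delta> S n x = (\<Oplus>\<^bsub>hspace (cliff_quotient \<delta> S) n\<^esub>w\<in>of_size S n.
          c w \<odot>\<^bsub>hspace (cliff_quotient \<delta> S) n\<^esub> Fcl \<delta> S w) \<longleftrightarrow>
      (\<forall>w\<in>of_size S n. F_coeff w x = c w)" for c
  proof -
    let ?y = "\<Sum>w\<in>of_size S n. scale (c w) (F_elem \<delta> w)"
    have "?y \<in> homog \<delta> n"
      by (intro lin.span_sum lin.span_scale F_elem_of_size_homog)
    then show ?thesis
      by (simp add: finsum_Fcl[OF S] coset_eq_iff x F_coeff_sum_F_elem[OF S])
  qed
  show ?thesis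
    unfolding F_coords_def * by (intro the_equality) auto
qed

text \<open>By \<open>F_coeff_pcomp\<close>, a coefficient of the composite at a word of
  \<open>S\<close> is a product of coefficients at its two reduced factors. Closure by subword
  reduction puts these in \<open>S\<close>, so the product depends only on the classes of
  \<open>x\<close> and \<open>y\<close>, and the union of classes defining \<open>pcomp\<close> is a
  single class.\<close>

lemma pcomp_coset:
  fixes x y :: "'k::field_char_0 lin"
  assumes S: "S \<subseteq> cliffs \<delta>" "closed_by_subword_reduction \<delta> S"
    and x: "x \<in> homog \<delta> n" and y: "y \<in> homog \<delta> m" and m: "1 \<le> m" and i: "1 \<le> i" "i \<le> n"
  shows "pcomp (cliff_quotient \<delta> S) n m i (coset \<delta> S n x) (coset \<delta> S m y) =
    coset \<delta> S (n + m - 1) (cliff_pcomp \<delta> i x y)"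
proof -
  let ?k = "n + m - 1"
  have *: "ideal_of \<delta> S ?k +>\<^bsub>cliff_space \<delta> ?k\<^esub> cliff_pcomp \<delta> i a b =
      coset \<delta> S ?k (cliff_pcomp \<delta> i x y)"
    if "a \<in> coset \<delta> S n x" "b \<in> coset \<delta> S m y" for a b
  proof -
    have a: "a \<in> homog \<delta> n" and b: "b \<in> homog \<delta> m" using that by (simp_all add: coset_def)
    have "F_coeff w (cliff_pcomp \<delta> i a b) = F_coeff w (cliff_pcomp \<delta> i x y)"
      if w: "w \<in> of_size S ?k" for w
    proof -
      have wc: "w \<in> of_size (cliffs \<delta>) ?k" using w S(1) by (auto simp: of_size_def)
      have "w \<in> S" and len: "length w = n - 1 + (m - 1)"
        using w m i by (auto simp: of_size_def size_word_def)
      have "i - 1 + (m - 1) \<le> length w" using len i by simp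
      then have "size_word (outer i (m - 1) w) = n" "size_word (inner i (m - 1) w) = m"
        using len m i by (simp_all add: size_word_def length_outer length_inner)
      then have "reduct \<delta> (outer i (m - 1) w) \<in> of_size S n"
        "reduct \<delta> (inner i (m - 1) w) \<in> of_size S m"
        using S(2) \<open>w \<in> S\<close> subseq_outer subseq_inner
        by (auto simp: closed_by_subword_reduction_def of_size_def size_word_def)
      then show ?thesis
        using \<open>a \<in> coset \<delta> S n x\<close> \<open>b \<in> coset \<delta> S m y\<close>
        by (simp add: F_coeff_pcomp[OF a b wc m i] F_coeff_pcomp[OF x y wc m i])
          (simp add: coset_def)
    qed
    then have "coset \<delta> S ?k (cliff_pcomp \<delta> i a b) = coset \<delta> S ?k (cliff_pcomp \<delta> i x y)"
      using coset_eq_iff cliff_pcomp_homog[OF a b] cliff_pcomp_homog[OF x y] by blast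
    then show ?thesis using r_coset_eq_coset[OF S(1) cliff_pcomp_homog[OF a b]] by simp
  qed
  have "pcomp (cliff_quotient \<delta> S) n m i (coset \<delta> S n x) (coset \<delta> S m y) =
      (\<Union>a\<in>coset \<delta> S n x. \<Union>b\<in>coset \<delta> S m y.
        ideal_of \<delta> S ?k +>\<^bsub>cliff_space \<delta> ?k\<^esub> cliff_pcomp \<delta> i a b)"
    by (simp add: cliff_quotient_def quotient_operad_def cliff_operad_def)
  also have "\<dots> = coset \<delta> S ?k (cliff_pcomp \<delta> i x y)"
    using * self_in_coset[OF x, of S] self_in_coset[OF y, of S] by blast
  finally show ?thesis .
qed

lemma F_coeff_pcomp_F_elem:
  assumes S: "S \<subseteq> cliffs \<delta>" and u: "u \<in> S" and v: "v \<in> S" and i: "1 \<le> i" "i \<le> size_word u"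
    and w: "w \<in> of_size (cliffs \<delta>) (size_word u + size_word v - 1)"
  shows "F_coeff w (cliff_pcomp \<delta> i (F_elem \<delta> u) (F_elem \<delta> v)) =
    (if w \<in> interval (cliffs \<delta>) (white_comp u i v) (black_comp \<delta> u i v) then 1 else 0)"
proof -
  have u': "u \<in> cliffs \<delta>" and v': "v \<in> cliffs \<delta>" and w': "w \<in> cliffs \<delta>"
    and len: "length w = length u + length v"
    using u v w S by (auto simp: of_size_def size_word_def)
  \<comment> \<open>Arity exceeds length by one, so the inner factor for \<open>v\<close> has length
    \<open>length v\<close>.\<close>
  have m: "1 \<le> size_word v" "size_word v - 1 = length v" by (simp_all add: size_word_def)
  have "F_coeff w (cliff_pcomp \<delta> i (F_elem \<delta> u) (F_elem \<delta> v)) =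
      F_coeff (reduct \<delta> (outer i (length v) w)) (F_elem \<delta> u) *
      F_coeff (reduct \<delta> (inner i (length v) w)) (F_elem \<delta> v)"
    using F_coeff_pcomp[OF F_elem_homog[OF refl] F_elem_homog[OF refl] w m(1) i] m(2) by simp
  also have "\<dots> =
      (if w \<in> interval (cliffs \<delta>) (white_comp u i v) (black_comp \<delta> u i v) then 1 else 0)"
    using between_white_black_iff[OF u' v' w' i len] w'
    by (auto simp: F_coeff_F_elem reduct_in_cliffs interval_def)
  finally show ?thesis .
qed

section \<open>Projections onto a sublattice\<close>

lemma meet_proj_le_iff:
  assumes "\<forall>n\<ge>1. sublattice (of_size S n)" "w \<in> S" "{w \<in> S. a \<preceq> w} \<noteq> {}"
  shows "meet_proj S a \<preceq> w \<longleftrightarrow> a \<preceq> w"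
proof
  have m: "is_minimal {w' \<in> S. a \<preceq> w'} (meet_proj S a)"
    unfolding meet_proj_def by (rule theI', rule ex1_minimal) (use assms in auto)
  then have mS: "meet_proj S a \<in> S" "a \<preceq> meet_proj S a" by (auto simp: is_minimal_def)
  show "a \<preceq> w" if "meet_proj S a \<preceq> w" using mS that cliff_le_trans by blast
  assume aw: "a \<preceq> w"
  \<comment> \<open>The componentwise minimum lies in \<open>S\<close>, above \<open>a\<close> and
    below the projection. Minimality makes it equal to the projection, which is therefore below
    \<open>w\<close>.\<close>
  let ?c = "map2 min (meet_proj S a) w"
  have "?c \<in> of_size S (size_word a)"
    using assms(1,2) mS aw by (auto simp: sublattice_def of_size_def size_word_def cliff_le_iff)
  moreover have "a \<preceq> ?c" "?c \<preceq> meet_proj S a" "?c \<preceq> w"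
    using mS aw by (auto simp: cliff_le_iff)
  ultimately show "meet_proj S a \<preceq> w"
    using m unfolding is_minimal_def of_size_def by force
qed

lemma le_join_proj_iff:
  assumes "\<forall>n\<ge>1. sublattice (of_size S n)" "w \<in> S" "{w \<in> S. w \<preceq> b} \<noteq> {}"
  shows "w \<preceq> join_proj S b \<longleftrightarrow> w \<preceq> b"
proof
  have m: "is_maximal {w' \<in> S. w' \<preceq> b} (join_proj S b)"
    unfolding join_proj_def by (rule theI', rule ex1_maximal) (use assms in auto)
  then have mS: "join_proj S b \<in> S" "join_proj S b \<preceq> b" by (auto simp: is_maximal_def)
  show "w \<preceq> b" if "w \<preceq> join_proj S b" using mS that cliff_le_trans by blast
  assume wb: "w \<preceq> b"
  \<comment> \<open>Dually, the componentwise maximum lies in \<open>S\<close> and below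
    \<open>b\<close>, so maximality identifies it with the projection.\<close>
  let ?c = "map2 max (join_proj S b) w"
  have "?c \<in> of_size S (size_word b)"
    using assms(1,2) mS wb by (auto simp: sublattice_def of_size_def size_word_def cliff_le_iff)
  moreover have "?c \<preceq> b" "join_proj S b \<preceq> ?c" "w \<preceq> ?c"
    using mS wb by (auto simp: cliff_le_iff)
  ultimately show "w \<preceq> join_proj S b"
    using m unfolding is_maximal_def of_size_def by force
qed

section \<open>Composition of fundamental elements in the quotient, and its support\<close>

theorem theorem3p2p2:
  fixes \<delta> :: "nat \<Rightarrow> nat"
    and S :: "nat list set"
  assumes "unimodal \<delta>"
    and "S \<subseteq> cliffs \<delta>"
    and "S \<noteq> {}"
    and "closed_by_subword_reduction \<delta> S"
  shows "let Q = (cliff_quotient \<delta> S :: ('k::field_char_0, 'k lin set) ns_operad) in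
    (\<forall>u\<in>S. \<forall>v\<in>S. \<forall>i\<in>{1..size_word u}.
      pcomp Q (size_word u) (size_word v) i (Fcl \<delta> S u) (Fcl \<delta> S v) =
        chi \<delta> (white_comp u i v) \<odot>\<^bsub>hspace Q (size_word u + size_word v - 1)\<^esub>
          (\<Oplus>\<^bsub>hspace Q (size_word u + size_word v - 1)\<^esub>
             w\<in>interval (cliffs \<delta>) (white_comp u i v) (black_comp \<delta> u i v) \<inter> S. Fcl \<delta> S w)) \<and>
    ((\<forall>n\<ge>1. sublattice (of_size S n)) \<longrightarrow>
      (\<forall>u\<in>S. \<forall>v\<in>S. \<forall>i\<in>{1..size_word u}.
        pcomp Q (size_word u) (size_word v) i (Fcl \<delta> S u) (Fcl \<delta> S v)
            \<noteq> \<zero>\<^bsub>hspace Q (size_word u + size_word v - 1)\<^esub> \<longrightarrow>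
        F_support \<delta> S (size_word u + size_word v - 1)
            (pcomp Q (size_word u) (size_word v) i (Fcl \<delta> S u) (Fcl \<delta> S v)) =
          interval S (meet_proj S (white_comp u i v)) (join_proj S (black_comp \<delta> u i v))))"
proof -
  note S = assms(2,4)
  let ?Q = "cliff_quotient \<delta> S :: ('k, 'k lin set) ns_operad"
  let ?k = "\<lambda>u v. size_word u + size_word v - 1"
  let ?p = "\<lambda>u i v. cliff_pcomp \<delta> i (F_elem \<delta> u) (F_elem \<delta> v) :: 'k lin"
  let ?P = "\<lambda>u i v. pcomp ?Q (size_word u) (size_word v) i (Fcl \<delta> S u) (Fcl \<delta> S v)"
  let ?I = "\<lambda>u i v. interval (cliffs \<delta>) (white_comp u i v) (black_comp \<delta> u i v) \<inter> S"
  \<comment> \<open>Everything below is read off these facts: a homogeneous representative of the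
    composite, and its coefficients on \<open>S\<close>, which are the indicator of
    \<open>?I u i v\<close>.\<close>
  have P: "?P u i v = coset \<delta> S (?k u v) (?p u i v)"
    and p: "?p u i v \<in> homog \<delta> (?k u v)"
    and coeff: "\<And>w. w \<in> of_size S (?k u v) \<Longrightarrow>
      F_coeff w (?p u i v) = (if w \<in> ?I u i v then 1 else 0)"
    if uv: "u \<in> S" "v \<in> S" and i: "i \<in> {1..size_word u}" for u v i
  proof -
    have F: "F_elem \<delta> u \<in> homog \<delta> (size_word u)" "F_elem \<delta> v \<in> homog \<delta> (size_word v)"
      by (rule F_elem_homog[OF refl])+
    show "?p u i v \<in> homog \<delta> (?k u v)" by (rule cliff_pcomp_homog[OF F])
    have i': "1 \<le> i" "i \<le> size_word u" using i by auto
    have "1 \<le> size_word v" by (simp add: size_word_def)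
    then show "?P u i v = coset \<delta> S (?k u v) (?p u i v)"
      using pcomp_coset[OF S F _ i'] Fcl_eq_coset[OF S(1) refl] by metis
    fix w assume "w \<in> of_size S (?k u v)"
    moreover from this have "w \<in> of_size (cliffs \<delta>) (?k u v)"
      using S(1) by (auto simp: of_size_def)
    ultimately show "F_coeff w (?p u i v) = (if w \<in> ?I u i v then 1 else 0)"
      using F_coeff_pcomp_F_elem[OF S(1) uv i', of w] by (auto simp: of_size_def)
  qed
  have I: "?I u i v \<subseteq> of_size S (?k u v)" for u i v
    by (auto simp: interval_def of_size_def size_word_def cliff_le_iff)
  have "?P u i v = chi \<delta> (white_comp u i v) \<odot>\<^bsub>hspace ?Q (?k u v)\<^esub>
      (\<Oplus>\<^bsub>hspace ?Q (?k u v)\<^esub>w\<in>?I u i v. Fcl \<delta> S w)"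
    if uv: "u \<in> S" "v \<in> S" and i: "i \<in> {1..size_word u}" for u v i
  proof -
    \<comment> \<open>The factors \<open>scale 1\<close> give the sum the shape required by
      \<open>F_coeff_sum_F_elem\<close>, with all coefficients 1.\<close>
    let ?s = "\<Sum>w\<in>?I u i v. scale 1 (F_elem \<delta> w) :: 'k lin"
    have F: "F_elem \<delta> w \<in> homog \<delta> (?k u v)" if "w \<in> ?I u i v" for w
      using that I by (intro F_elem_of_size_homog) blast
    then have s: "?s \<in> homog \<delta> (?k u v)" by (auto intro!: lin.span_sum)
    have "finite (?I u i v)"
      by (rule finite_subset[OF _ finite_cliff_le[of "black_comp \<delta> u i v"]])
        (auto simp: interval_def)
    then have "(\<Oplus>\<^bsub>hspace ?Q (?k u v)\<^esub>w\<in>?I u i v. coset \<delta> S (?k u v) (F_elem \<delta> w)) =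
        coset \<delta> S (?k u v) ?s"
      using finsum_quotient[OF S(1) _ F, of "?I u i v" "\<lambda>w. w"] by simp
    moreover have "(\<Oplus>\<^bsub>hspace ?Q (?k u v)\<^esub>w\<in>?I u i v. coset \<delta> S (?k u v) (F_elem \<delta> w)) =
        (\<Oplus>\<^bsub>hspace ?Q (?k u v)\<^esub>w\<in>?I u i v. Fcl \<delta> S w)"
    proof (rule abelian_monoid.finsum_cong'[OF abelian_monoid_quotient[OF S(1)] refl])
      show cl: "coset \<delta> S (?k u v) (F_elem \<delta> w) = (Fcl \<delta> S w :: 'k lin set)"
        if "w \<in> ?I u i v" for w
        using that I by (intro Fcl_eq_coset[OF S(1), symmetric]) (auto simp: of_size_def)
      show "(\<lambda>w. Fcl \<delta> S w) \<in> ?I u i v \<rightarrow> carrier (hspace ?Q (?k u v))"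
        unfolding carrier_quotient[OF S(1)] by (intro Pi_I, rule image_eqI, erule cl[symmetric], erule F)
    qed
    moreover have "coset \<delta> S (?k u v) (?p u i v) =
        coset \<delta> S (?k u v) (scale (chi \<delta> (white_comp u i v)) ?s)"
    proof (subst coset_eq_iff[OF p[OF uv i] lin.span_scale[OF s]], intro ballI)
      fix w assume w: "w \<in> of_size S (?k u v)"
      \<comment> \<open>For \<open>w\<close> in \<open>?I u i v\<close> the white composite lies
        below a cliff, hence is one. For the other words of \<open>S\<close> of this size both
        coefficients compared below are 0.\<close>
      have "w \<in> ?I u i v \<Longrightarrow> chi \<delta> (white_comp u i v) = (1 :: 'k)"
        by (auto simp: interval_def chi_def dest: cliff_le_cliffs)
      then show "F_coeff w (?p u i v) = F_coeff w (scale (chi \<delta> (white_comp u i v)) ?s)"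
        using coeff[OF uv i w] F_coeff_sum_F_elem[OF S(1) w I[of u i v], of "\<lambda>_. 1 :: 'k"]
        by (simp add: F_coeff_scale)
    qed
    ultimately show ?thesis using P[OF uv i] smult_quotient[OF S(1) s] by simp
  qed
  moreover have "F_support \<delta> S (?k u v) (?P u i v) =
      interval S (meet_proj S (white_comp u i v)) (join_proj S (black_comp \<delta> u i v))"
    if lat: "\<forall>n\<ge>1. sublattice (of_size S n)"
      and uv: "u \<in> S" "v \<in> S" and i: "i \<in> {1..size_word u}"
      and nz: "?P u i v \<noteq> \<zero>\<^bsub>hspace ?Q (?k u v)\<^esub>" for u v i
  proof -
    \<comment> \<open>A nonzero class has a nonzero coefficient at some word of \<open>S\<close>.
      That word lies in \<open>?I u i v\<close>, which gives the nonemptiness under which both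
      projections exist.\<close>
    have "coset \<delta> S (?k u v) (?p u i v) \<noteq> coset \<delta> S (?k u v) 0"
      using nz P[OF uv i] zero_quotient[OF S(1)] by metis
    then obtain w where w: "w \<in> of_size S (?k u v)" "F_coeff w (?p u i v) \<noteq> 0"
      using coset_eq_iff[OF p[OF uv i] lin.span_zero] by (auto simp only: F_coeff_zero)
    then have "w \<in> ?I u i v"
      using coeff[OF uv i w(1)] by metis
    then have ne: "{w \<in> S. white_comp u i v \<preceq> w} \<noteq> {}" "{w \<in> S. w \<preceq> black_comp \<delta> u i v} \<noteq> {}"
      by (auto simp: interval_def)
    have "F_support \<delta> S (?k u v) (?P u i v) =
        {w \<in> of_size S (?k u v). F_coeff w (?p u i v) \<noteq> 0}"
      unfolding F_support_def P[OF uv i] F_coords_coset[OF S(1) p[OF uv i]] by auto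
    \<comment> \<open>The coefficients are 0 or 1, so the support is the set where they equal
      1.\<close>
    also have "\<dots> = {w \<in> of_size S (?k u v). w \<in> ?I u i v}"
      by (rule Collect_cong, rule conj_cong[OF refl], subst coeff[OF uv i]) simp_all
    also have "\<dots> = ?I u i v"
      using I[of u i v] by blast
    \<comment> \<open>For words of \<open>S\<close>, each bound may be replaced by its
      projection.\<close>
    also have "\<dots> = interval S (meet_proj S (white_comp u i v)) (join_proj S (black_comp \<delta> u i v))"
      using S(1) meet_proj_le_iff[OF lat _ ne(1)] le_join_proj_iff[OF lat _ ne(2)]
      by (auto simp: interval_def)
    finally show ?thesis .
  qed
  ultimately show ?thesis unfolding Let_def by blast
qed

end
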